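(* Let $n \geq 5$ and let $G = CS_{4,n-4}$ be the cycle-star graph with cycle length $k=4$ and $n-k \geq 1$ pendant vertices. Then $es(G) = n-2$.
   Context: For integers $k \geq 3$ and $n > k$, the cycle-star graph $CS_{k,n-k}$ is the simple graph on $n$ vertices consisting of a cycle of length $k$ together with $n-k$ additional vertices of degree one (leaves), all adjacent to the same single vertex of the cycle. For a simple graph $G$, a vertex $k$-labeling is a map $\phi: V(G) \to \{1,2,\ldots,k\}$; the weight of an edge $uv$ is $w_\phi(uv) = \phi(u)+\phi(v)$. The labeling is an edge irregular $k$-labeling if distinct edges have distinct weights. The edge irregularity strength $es(G)$ is the minimum $k$ for which $G$ admits an edge irregular $k$-labeling. *)

theory Defs
  imports "HOL-Library.Ramsey"
begin

text \<open>A simple graph is given by a vertex set \<open>V\<close> and a set \<open>E\<close> of two-element subsets of \<open>V\<close>.\<close>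

definition simple_graph :: "'a set \<Rightarrow> 'a set set \<Rightarrow> bool" where
  "simple_graph V E \<longleftrightarrow> finite V \<and> E \<subseteq> nsets V 2"

text \<open>In \<open>is_cycle_star k m V E\<close> the list \<open>c\<close> runs once around the cycle, starting at the vertex
  that carries the leaves, and \<open>L\<close> is the set of leaves.\<close>

definition is_cycle_star :: "nat \<Rightarrow> nat \<Rightarrow> 'a set \<Rightarrow> 'a set set \<Rightarrow> bool" where
  "is_cycle_star k m V E \<longleftrightarrow> 3 \<le> k \<and> 1 \<le> m \<and>
     (\<exists>c L. distinct c \<and> length c = k \<and> finite L \<and> card L = m \<and> set c \<inter> L = {} \<and>
        V = set c \<union> L \<and>
        E = {{c ! i, c ! (Suc i mod k)} | i. i < k} \<union> {{c ! 0, l} | l. l \<in> L})"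

definition vertex_labeling :: "nat \<Rightarrow> 'a set \<Rightarrow> ('a \<Rightarrow> nat) \<Rightarrow> bool" where
  "vertex_labeling k V \<phi> \<longleftrightarrow> (\<forall>v\<in>V. \<phi> v \<in> {1..k})"

definition edge_weight :: "('a \<Rightarrow> nat) \<Rightarrow> 'a set \<Rightarrow> nat" where
  "edge_weight \<phi> e = (\<Sum>v\<in>e. \<phi> v)"

definition edge_irregular_labeling ::
    "nat \<Rightarrow> 'a set \<Rightarrow> 'a set set \<Rightarrow> ('a \<Rightarrow> nat) \<Rightarrow> bool" where
  "edge_irregular_labeling k V E \<phi> \<longleftrightarrow>
     vertex_labeling k V \<phi> \<and>
     (\<forall>e\<in>E. \<forall>f\<in>E. e \<noteq> f \<longrightarrow> edge_weight \<phi> e \<noteq> edge_weight \<phi> f)"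

definition es :: "'a set \<Rightarrow> 'a set set \<Rightarrow> nat" where
  "es V E = (LEAST k. \<exists>\<phi>. edge_irregular_labeling k V E \<phi>)"

lemma edge_weight_pair: "u \<noteq> v \<Longrightarrow> edge_weight \<phi> {u, v} = \<phi> u + \<phi> v"
  by (simp add: edge_weight_def)

lemma is_cycle_star_simple_graph:
  assumes "is_cycle_star k m V E"
  shows "simple_graph V E" and "card V = k + m"
proof -
  obtain c L where cL: "3 \<le> k" "distinct c" "length c = k" "finite L" "card L = m"
      "set c \<inter> L = {}" "V = set c \<union> L"
      and E: "E = {{c ! i, c ! (Suc i mod k)} | i. i < k} \<union> {{c ! 0, l} | l. l \<in> L}"
    using assms unfolding is_cycle_star_def by blast
  show "card V = k + m"
    using cL by (simp add: card_Un_disjoint distinct_card)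
  have "{c ! i, c ! (Suc i mod k)} \<in> nsets V 2" if "i < k" for i
  proof -
    have lt: "Suc i mod k < k" using cL(1) by simp
    have "i \<noteq> Suc i mod k"
      using that cL(1) by (cases "Suc i = k") auto
    then have "c ! i \<noteq> c ! (Suc i mod k)"
      using that lt cL by (simp add: nth_eq_iff_index_eq)
    then show ?thesis
      using that lt cL by (auto simp: nsets_def)
  qed
  moreover have "{c ! 0, l} \<in> nsets V 2" if "l \<in> L" for l
  proof -
    have "c ! 0 \<in> set c" using cL by (intro nth_mem) auto
    moreover from this have "c ! 0 \<noteq> l" using that cL(6) by blast
    ultimately show ?thesis using that cL(7) by (simp add: nsets_def)
  qed
  ultimately have "E \<subseteq> nsets V 2"
    unfolding E by blast
  then show "simple_graph V E"
    unfolding simple_graph_def using cL(4,7) by simp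
qed

lemma is_cycle_star_exists:
  assumes "3 \<le> k" "1 \<le> m"
  shows "is_cycle_star k m {..<k + m}
    ({{i, Suc i mod k} | i. i < k} \<union> {{0, l} | l. l \<in> {k..<k + m}})"
proof -
  have "{{i, Suc i mod k} | i. i < k} = {{[0..<k] ! i, [0..<k] ! (Suc i mod k)} | i. i < k}"
    by (rule Collect_cong, rule ex_cong1) auto
  moreover have "[0..<k] ! 0 = 0" using assms by simp
  ultimately show ?thesis
    unfolding is_cycle_star_def using assms
    by (intro conjI exI[of _ "[0..<k]"] exI[of _ "{k..<k + m}"]) auto
qed

end

theory Submission imports Defs begin

text \<open>The vertex carrying the leaves has \<open>n - 2\<close> neighbours, whose labels must be distinct.
  Conversely, with \<open>k = n - 2\<close>, give that vertex label 1, its neighbours the labels \<open>1, \<dots>, k\<close>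
  with \<open>k\<close> and \<open>k - 1\<close> on the cycle, and the opposite cycle vertex label \<open>k\<close>. The edges at the
  first vertex get weights \<open>2, \<dots>, k + 1\<close> and the other two get \<open>2k - 1\<close> and \<open>2k\<close>.\<close>

text \<open>Edges at \<open>a\<close> share the summand \<open>\<phi> a\<close>, so distinct weights
  force distinct labels on \<open>S\<close>, and only \<open>k\<close> labels are available. Since
  \<open>a\<close> lies outside \<open>S\<close>, each \<open>{a, s}\<close> is a genuine pair and
  its weight, a sum over a set, really has two summands.\<close>

lemma edge_irregular_labeling_card_neighbours_le:
  assumes lab: "edge_irregular_labeling k V E \<phi>"
    and "S \<subseteq> V" "a \<notin> S" and adj: "\<And>s. s \<in> S \<Longrightarrow> {a, s} \<in> E"
  shows "card S \<le> k"
proof -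
  have "inj_on \<phi> S"
  proof (rule inj_onI, rule ccontr)
    fix s t assume st: "s \<in> S" "t \<in> S" "\<phi> s = \<phi> t" "s \<noteq> t"
    then have "edge_weight \<phi> {a, s} = edge_weight \<phi> {a, t}"
      using \<open>a \<notin> S\<close> by (metis edge_weight_pair)
    moreover have "{a, s} \<noteq> {a, t}"
      using st by (auto simp: doubleton_eq_iff)
    ultimately show False
      using lab adj[OF st(1)] adj[OF st(2)] unfolding edge_irregular_labeling_def by metis
  qed
  moreover have "\<phi> ` S \<subseteq> {1..k}"
    using lab \<open>S \<subseteq> V\<close> unfolding edge_irregular_labeling_def vertex_labeling_def by blast
  ultimately have "card S \<le> card {1..k}"
    by (intro card_inj_on_le) auto
  then show ?thesis by simp
qed

text \<open>Replaces cycle indices by named vertices: \<open>a\<close> carries the leaves and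
  \<open>c\<close> is opposite to it. All edges at \<open>a\<close> are gathered into one image over
  its neighbours \<open>{b, d} \<union> L\<close>, the form that both bounds use.\<close>

lemma is_cycle_star_4E:
  assumes "is_cycle_star 4 m V E"
  obtains a b c d L where "distinct [a, b, c, d]" "finite L" "card L = m" "1 \<le> m"
    "{a, b, c, d} \<inter> L = {}" "V = {a, b, c, d} \<union> L"
    "E = {{b, c}, {c, d}} \<union> (\<lambda>s. {a, s}) ` ({b, d} \<union> L)"
proof -
  obtain xs L where xs: "distinct xs" "length xs = 4" "set xs \<inter> L = {}" "V = set xs \<union> L"
    and L: "finite L" "card L = m" "1 \<le> m"
    and E: "E = {{xs ! i, xs ! (Suc i mod 4)} | i. i < 4} \<union> {{xs ! 0, l} | l. l \<in> L}"
    using assms unfolding is_cycle_star_def by blast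
  obtain a b c d where abcd: "xs = [a, b, c, d]"
    using xs(2) by (auto simp: numeral_eq_Suc length_Suc_conv)
  have "{{xs ! i, xs ! (Suc i mod 4)} | i. i < 4} =
      (\<lambda>i. {xs ! i, xs ! (Suc i mod 4)}) ` {0, 1, 2, 3}"
  proof -
    have "{i. i < 4} = {0, 1, 2, 3 :: nat}" by auto
    then show ?thesis by (simp only: setcompr_eq_image)
  qed
  \<comment> \<open>Index 3 wraps around to 0 and yields \<open>{d, a}\<close>, which is turned
    round so that \<open>a\<close> comes first, as in the star.\<close>
  also have "\<dots> = {{a, b}, {b, c}, {c, d}, {a, d}}"
    by (simp add: abcd insert_commute[of d a])
  finally have "E = {{a, b}, {b, c}, {c, d}, {a, d}} \<union> (\<lambda>s. {a, s}) ` L"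
    unfolding E by (simp add: abcd setcompr_eq_image)
  also have "\<dots> = {{b, c}, {c, d}} \<union> (\<lambda>s. {a, s}) ` ({b, d} \<union> L)"
    unfolding image_Un image_insert image_empty by blast
  finally have "E = {{b, c}, {c, d}} \<union> (\<lambda>s. {a, s}) ` ({b, d} \<union> L)" .
  then show thesis
    using that[of a b c d L] xs L abcd by simp
qed

lemma cycle_star_4_edge_irregular_labeling:
  assumes "is_cycle_star 4 m V E"
  shows "\<exists>\<phi>. edge_irregular_labeling (m + 2) V E \<phi>"
proof -
  obtain a b c d L where dist: "distinct [a, b, c, d]" and L: "finite L" "card L = m" "1 \<le> m"
    and disj: "{a, b, c, d} \<inter> L = {}" and V: "V = {a, b, c, d} \<union> L"
    and E: "E = {{b, c}, {c, d}} \<union> (\<lambda>s. {a, s}) ` ({b, d} \<union> L)"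
    by (rule is_cycle_star_4E[OF assms])
  obtain f where f: "bij_betw f L {1..m}"
    using finite_same_card_bij[OF \<open>finite L\<close>, of "{1..m}"] L by auto
  \<comment> \<open>The leaves use up \<open>1, ..., m\<close>, leaving the two largest labels for
    \<open>b\<close> and \<open>d\<close>. Repeating \<open>m + 2\<close> at \<open>c\<close> is
    harmless, as \<open>c\<close> is not adjacent to \<open>a\<close>, and it makes the two edges at
    \<open>c\<close> heavy.\<close>
  define \<phi> where "\<phi> = f(a := 1, b := m + 2, c := m + 2, d := m + 1)"
  have \<phi>: "\<phi> a = 1" "\<phi> b = m + 2" "\<phi> c = m + 2" "\<phi> d = m + 1"
    using dist by (auto simp: \<phi>_def)
  have \<phi>L: "\<phi> l = f l" if "l \<in> L" for l
    using that disj by (auto simp: \<phi>_def)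
  have range: "\<phi> l \<in> {1..m}" if "l \<in> L" for l
    using that f \<phi>L by (auto simp: bij_betw_def)
  have "inj_on \<phi> L"
    using f \<phi>L by (metis bij_betw_imp_inj_on inj_on_cong)
  then have inj: "inj_on \<phi> ({b, d} \<union> L)"
    using range \<phi> by (force simp: inj_on_Un)
  have wa: "edge_weight \<phi> {a, s} = 1 + \<phi> s" if "s \<in> {b, d} \<union> L" for s
  proof -
    have "a \<noteq> s" using that dist disj by auto
    then show ?thesis by (simp add: edge_weight_pair \<phi>)
  qed
  \<comment> \<open>The bound is attained at \<open>b\<close>. It lies strictly below the smaller
    remaining weight \<open>2 * m + 3\<close> because there is at least one leaf.\<close>
  have small: "1 + \<phi> s \<le> m + 3" if "s \<in> {b, d} \<union> L" for s
    using that range[of s] \<phi> by auto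
  have w: "edge_weight \<phi> {b, c} = 2 * m + 4" "edge_weight \<phi> {c, d} = 2 * m + 3"
    using dist by (auto simp: edge_weight_pair \<phi>)
  define A where "A = (\<lambda>s. {a, s}) ` ({b, d} \<union> L)"
  have injA: "inj_on (edge_weight \<phi>) A"
    unfolding A_def
  proof (rule inj_onI, elim imageE)
    fix e g s t
    assume *: "edge_weight \<phi> e = edge_weight \<phi> g" "e = {a, s}" "g = {a, t}"
      "s \<in> {b, d} \<union> L" "t \<in> {b, d} \<union> L"
    then have "\<phi> s = \<phi> t" using wa[of s] wa[of t] by simp
    then have "s = t" using * inj_onD[OF inj] by blast
    then show "e = g" using * by simp
  qed
  have wA: "edge_weight \<phi> e \<le> m + 3" if "e \<in> A" for e
    using that wa small unfolding A_def by (metis (no_types, lifting) imageE)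
  \<comment> \<open>The two edges at \<open>c\<close> are added to the star one at a time; each time
    it suffices that the weight of the new edge is not yet taken.\<close>
  have "inj_on (edge_weight \<phi>) (insert {b, c} (insert {c, d} A))"
    unfolding inj_on_insert
  proof (intro conjI injA)
    show "edge_weight \<phi> {c, d} \<notin> edge_weight \<phi> ` (A - {{c, d}})"
      using wA w \<open>1 \<le> m\<close> by fastforce
    show "edge_weight \<phi> {b, c} \<notin> edge_weight \<phi> ` (insert {c, d} A - {{b, c}})"
      using wA w \<open>1 \<le> m\<close> by fastforce
  qed
  moreover have "insert {b, c} (insert {c, d} A) = E"
    unfolding E A_def by (simp only: Un_insert_left Un_empty_left)
  ultimately have "inj_on (edge_weight \<phi>) E"
    by simp
  moreover have "vertex_labeling (m + 2) V \<phi>"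
    unfolding vertex_labeling_def V using range \<phi> by fastforce
  ultimately show ?thesis
    unfolding edge_irregular_labeling_def inj_on_def by blast
qed

theorem theorem3p3:
  fixes n :: nat and V :: "'a set" and E :: "'a set set"
  assumes "n \<ge> 5"
    and "is_cycle_star 4 (n - 4) V E"
  shows "es V E = n - 2"
  unfolding es_def
proof (rule Least_equality)
  \<comment> \<open>Subtraction on \<open>nat\<close> truncates, so this relies on the lower bound
    for \<open>n\<close>.\<close>
  have "n - 4 + 2 = n - 2" using assms(1) by simp
  then show "\<exists>\<phi>. edge_irregular_labeling (n - 2) V E \<phi>"
    using cycle_star_4_edge_irregular_labeling[OF assms(2)] by simp
next
  fix k assume "\<exists>\<phi>. edge_irregular_labeling k V E \<phi>"
  then obtain \<phi> where lab: "edge_irregular_labeling k V E \<phi>" ..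
  obtain a b c d L where dist: "distinct [a, b, c, d]" and L: "finite L" "card L = n - 4"
    and disj: "{a, b, c, d} \<inter> L = {}" and V: "V = {a, b, c, d} \<union> L"
    and E: "E = {{b, c}, {c, d}} \<union> (\<lambda>s. {a, s}) ` ({b, d} \<union> L)"
    by (rule is_cycle_star_4E[OF assms(2)])
  \<comment> \<open>The lower bound counts all neighbours of \<open>a\<close>: two on the cycle and
    \<open>n - 4\<close> leaves.\<close>
  have "card ({b, d} \<union> L) \<le> k"
    by (rule edge_irregular_labeling_card_neighbours_le[OF lab, where a = a])
       (use dist disj in \<open>auto simp: V E\<close>)
  moreover have "card ({b, d} \<union> L) = n - 2"
    using dist disj L assms(1) by (subst card_Un_disjoint) auto
  ultimately show "n - 2 \<le> k" by simp
qed

end
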